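(* Let $K$ be a field of characteristic $p\neq 2,3$ and let $(A,\times)$ be an algebra over $K$. Then $(A,\times)$ is weak Leibniz if and only if its polarization $(A,\circ,\bullet)$ is transposed Poisson.
   Context: An algebra over a field $K$ is a $K$-vector space with a bilinear product (no associativity, commutativity or unit assumed); a dialgebra is a $K$-vector space with two bilinear products. Characteristic $p=0$ is allowed. An algebra $A$ with product written $ab$ is weak Leibniz if, with $[a,b]=ab-ba$, for all $a,b,c\in A$: $$[a,b]c=2a(bc)-2b(ac),\qquad a[b,c]=2(ab)c-2(ac)b.$$ The polarization of an algebra $(A,\times)$ is the dialgebra $(A,\circ,\bullet)$ with $a\circ b=\frac12(a\times b-b\times a)$ and $a\bullet b=\frac12(a\times b+b\times a)$. A dialgebra $(A,\circ,\bullet)$ is transposed Poisson if $(A,\circ)$ is a Lie algebra, $(A,\bullet)$ is an associative commutative algebra (not necessarily unital), and for all $a,b,c\in A$: $$2\,a\bullet(b\circ c)-(a\bullet b)\circ c-b\circ(a\bullet c)=0.$$ *)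

theory Defs
  imports Complex_Main
begin

locale nonassoc_algebra = vector_space scale
  for scale :: "'k::field \<Rightarrow> 'a::ab_group_add \<Rightarrow> 'a" (infixr \<open>*s\<close> 75) +
  fixes mult :: "'a \<Rightarrow> 'a \<Rightarrow> 'a" (infixl \<open>\<cdot>\<close> 76)
  assumes linear_left: "Vector_Spaces.linear scale scale (\<lambda>x. x \<cdot> y)"
    and linear_right: "Vector_Spaces.linear scale scale (\<lambda>y. x \<cdot> y)"

definition commutator :: "('a::ab_group_add \<Rightarrow> 'a \<Rightarrow> 'a) \<Rightarrow> 'a \<Rightarrow> 'a \<Rightarrow> 'a" where
  "commutator mult a b = mult a b - mult b a"

locale weak_leibniz_algebra = nonassoc_algebra +
  assumes weak_leibniz_left:
      "commutator mult a b \<cdot> c = 2 *s (a \<cdot> (b \<cdot> c)) - 2 *s (b \<cdot> (a \<cdot> c))"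
    and weak_leibniz_right:
      "a \<cdot> commutator mult b c = 2 *s ((a \<cdot> b) \<cdot> c) - 2 *s ((a \<cdot> c) \<cdot> b)"

locale lie_algebra = nonassoc_algebra +
  assumes alternating: "a \<cdot> a = 0"
    and jacobi: "a \<cdot> (b \<cdot> c) + b \<cdot> (c \<cdot> a) + c \<cdot> (a \<cdot> b) = 0"

locale comm_assoc_algebra = nonassoc_algebra scale mult + abel_semigroup mult
  for scale :: "'k::field \<Rightarrow> 'a::ab_group_add \<Rightarrow> 'a" (infixr \<open>*s\<close> 75)
    and mult :: "'a \<Rightarrow> 'a \<Rightarrow> 'a" (infixl \<open>\<cdot>\<close> 76)

locale transposed_poisson =
  lie: lie_algebra scale circ + comm: comm_assoc_algebra scale bullet
  for scale :: "'k::field \<Rightarrow> 'a::ab_group_add \<Rightarrow> 'a" (infixr \<open>*s\<close> 75)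
    and circ :: "'a \<Rightarrow> 'a \<Rightarrow> 'a" (infixl \<open>\<circ>\<^sub>L\<close> 76)
    and bullet :: "'a \<Rightarrow> 'a \<Rightarrow> 'a" (infixl \<open>\<bullet>\<^sub>C\<close> 76) +
  assumes transposed_leibniz:
    "2 *s (a \<bullet>\<^sub>C (b \<circ>\<^sub>L c)) - (a \<bullet>\<^sub>C b) \<circ>\<^sub>L c - b \<circ>\<^sub>L (a \<bullet>\<^sub>C c) = 0"

text \<open>The two products of the polarization; the scalar \<open>1 / 2\<close> is taken in the base field, and
  is the junk value \<open>0\<close> in characteristic 2.\<close>

definition polar_circ ::
    "('k::field \<Rightarrow> 'a::ab_group_add \<Rightarrow> 'a) \<Rightarrow> ('a \<Rightarrow> 'a \<Rightarrow> 'a) \<Rightarrow> 'a \<Rightarrow> 'a \<Rightarrow> 'a" where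
  "polar_circ scale mult a b = scale (1 / 2) (mult a b - mult b a)"

definition polar_bullet ::
    "('k::field \<Rightarrow> 'a::ab_group_add \<Rightarrow> 'a) \<Rightarrow> ('a \<Rightarrow> 'a \<Rightarrow> 'a) \<Rightarrow> 'a \<Rightarrow> 'a \<Rightarrow> 'a" where
  "polar_bullet scale mult a b = scale (1 / 2) (mult a b + mult b a)"

end

(* Write a b = a o b + a * b for the two products of the polarization. Passing to the opposite
   algebra changes the sign of o, fixes * and exchanges the two weak Leibniz identities, so the
   identities split into a part even in o and a part odd in o.

   The even part is J(a,b,c) + a*(b*c) - b*(a*c) = 0 with J the Jacobi sum. As J is cyclically
   invariant and the cyclic sum of the remaining terms vanishes, 3J = 0, so that the even part is
   the Jacobi identity together with the associativity of *.

   For the odd part put P_a = a*(b o c), Q_a = a o (b*c), and cyclically. It reads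
   P_c - P_a - P_b = Q_a - Q_b, and summing cyclically gives P_a + P_b + P_c = 0, so that it becomes
   2 P_c = Q_a - Q_b, the transposed Leibniz rule. The transposed Leibniz rule in turn gives
   2 (P_a + P_b + P_c) = 0, which leads back. *)

theory Submission
  imports Defs "HOL-Computational_Algebra.Primes"
begin

lemma of_nat_prime_neq_0:
  assumes "prime p" and "CHAR('k::field) \<noteq> p"
  shows "of_nat p \<noteq> (0::'k)"
proof
  assume "of_nat p = (0::'k)"
  then have "CHAR('k) dvd p"
    by (simp add: of_nat_eq_0_iff_char_dvd)
  \<comment> \<open>Characteristic 0 needs no separate case: it too would be a divisor of the prime
    \<open>p\<close>.\<close>
  then have "CHAR('k) = 1 \<or> CHAR('k) = p"
    using assms(1) unfolding prime_nat_iff by blast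
  with assms(2) show False
    using CHAR_not_1[where 'a='k] by simp
qed

context vector_space
begin

lemma scale_two: "2 *s x = x + x"
  using scale_left_distrib[of 1 1 x] by simp

lemma scale_three: "3 *s x = x + x + x"
  using scale_left_distrib[of 2 1 x] by (simp add: scale_two)

end

context nonassoc_algebra
begin

lemma add_left: "(x + y) \<cdot> z = x \<cdot> z + y \<cdot> z"
  and scale_left: "(r *s x) \<cdot> y = r *s (x \<cdot> y)"
  and add_right: "x \<cdot> (y + z) = x \<cdot> y + x \<cdot> z"
  and scale_right: "x \<cdot> (r *s y) = r *s (x \<cdot> y)"
  using linear_left linear_right by (simp_all add: Vector_Spaces.linear_iff)

lemma zero_left: "0 \<cdot> x = 0"
  and zero_right: "x \<cdot> 0 = 0"
  using add_left[of 0 0 x] add_right[of x 0 0] by simp_all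

lemma minus_left: "(- x) \<cdot> y = - (x \<cdot> y)"
  using add_left[of "- x" x y] by (simp add: zero_left eq_neg_iff_add_eq_0)

lemma minus_right: "x \<cdot> (- y) = - (x \<cdot> y)"
  using add_right[of x "- y" y] by (simp add: zero_right eq_neg_iff_add_eq_0)

lemma diff_left: "(x - y) \<cdot> z = x \<cdot> z - y \<cdot> z"
  using add_left[of x "- y" z] by (simp add: minus_left)

lemma diff_right: "x \<cdot> (y - z) = x \<cdot> y - x \<cdot> z"
  using add_right[of x y "- z"] by (simp add: minus_right)

lemmas bilinear_simps = add_left add_right diff_left diff_right minus_left minus_right
  scale_left scale_right

end

text \<open>An abstract stand-in for the two products of a polarization. Keeping the halves out of
  sight leaves only integer coefficients, and division is replaced by cancelling 2 or 3.\<close>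

locale polarized_algebra =
  circ: nonassoc_algebra scale circ + bullet: nonassoc_algebra scale bullet
  for scale :: "'k::field \<Rightarrow> 'a::ab_group_add \<Rightarrow> 'a" (infixr \<open>*s\<close> 75)
    and circ :: "'a \<Rightarrow> 'a \<Rightarrow> 'a" (infixl \<open>\<circ>\<^sub>L\<close> 76)
    and bullet :: "'a \<Rightarrow> 'a \<Rightarrow> 'a" (infixl \<open>\<bullet>\<^sub>C\<close> 76) +
  assumes alternating: "a \<circ>\<^sub>L a = 0"
    and commute: "a \<bullet>\<^sub>C b = b \<bullet>\<^sub>C a"
    and two_neq_0: "(2::'k) \<noteq> 0"
    and three_neq_0: "(3::'k) \<noteq> 0"
begin

lemma anticommute: "a \<circ>\<^sub>L b = - (b \<circ>\<^sub>L a)"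
proof -
  have "(a + b) \<circ>\<^sub>L (a + b) = a \<circ>\<^sub>L b + b \<circ>\<^sub>L a"
    unfolding circ.add_left circ.add_right by (simp add: alternating)
  then show ?thesis
    by (simp add: alternating eq_neg_iff_add_eq_0)
qed

lemma double_eq_0_iff: "x + x = 0 \<longleftrightarrow> x = 0" for x :: 'a
  using circ.scale_two[of x] two_neq_0 circ.scale_eq_0_iff[of 2 x] by simp

lemma triple_eq_0_iff: "x + x + x = 0 \<longleftrightarrow> x = 0" for x :: 'a
  using circ.scale_three[of x] three_neq_0 circ.scale_eq_0_iff[of 3 x] by simp

definition jacobi_sum :: "'a \<Rightarrow> 'a \<Rightarrow> 'a \<Rightarrow> 'a" where
  "jacobi_sum a b c = a \<circ>\<^sub>L (b \<circ>\<^sub>L c) + b \<circ>\<^sub>L (c \<circ>\<^sub>L a) + c \<circ>\<^sub>L (a \<circ>\<^sub>L b)"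

text \<open>Parity counts the factors \<open>\<circ>\<^sub>L\<close>: two or none in each term here,
  exactly one in each term of \<open>odd_part\<close>.\<close>

definition even_part :: "'a \<Rightarrow> 'a \<Rightarrow> 'a \<Rightarrow> 'a" where
  "even_part a b c = jacobi_sum a b c + (a \<bullet>\<^sub>C (b \<bullet>\<^sub>C c) - b \<bullet>\<^sub>C (a \<bullet>\<^sub>C c))"

definition odd_part :: "'a \<Rightarrow> 'a \<Rightarrow> 'a \<Rightarrow> 'a" where
  "odd_part a b c = a \<circ>\<^sub>L (b \<bullet>\<^sub>C c) - b \<circ>\<^sub>L (a \<bullet>\<^sub>C c)
    + a \<bullet>\<^sub>C (b \<circ>\<^sub>L c) + b \<bullet>\<^sub>C (c \<circ>\<^sub>L a) - c \<bullet>\<^sub>C (a \<circ>\<^sub>L b)"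

lemma even_part_eq_0_iff:
  "(\<forall>a b c. even_part a b c = 0) \<longleftrightarrow>
    (\<forall>a b c. jacobi_sum a b c = 0) \<and> (\<forall>a b c. a \<bullet>\<^sub>C b \<bullet>\<^sub>C c = a \<bullet>\<^sub>C (b \<bullet>\<^sub>C c))"
    (is "?E \<longleftrightarrow> ?J \<and> ?A")
proof
  assume E: ?E
  have J: ?J
  proof (intro allI)
    fix a b c
    have "jacobi_sum a b c + jacobi_sum a b c + jacobi_sum a b c =
        even_part a b c + even_part b c a + even_part c a b"
      using commute[of a b] commute[of b c] commute[of c a]
      by (simp add: even_part_def jacobi_sum_def algebra_simps)
    with E show "jacobi_sum a b c = 0"
      by (simp add: triple_eq_0_iff)
  qed
  have ?A
  proof (intro allI)
    fix a b c
    \<comment> \<open>Once the Jacobi sum is gone, the even part says that multiplications by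
      \<open>a\<close> and by \<open>c\<close> commute. For a commutative product this is
      associativity.\<close>
    have "a \<bullet>\<^sub>C (c \<bullet>\<^sub>C b) = c \<bullet>\<^sub>C (a \<bullet>\<^sub>C b)"
      using E[rule_format, of a c b] J by (simp add: even_part_def)
    then show "a \<bullet>\<^sub>C b \<bullet>\<^sub>C c = a \<bullet>\<^sub>C (b \<bullet>\<^sub>C c)"
      using commute[of "a \<bullet>\<^sub>C b" c] commute[of b c] by simp
  qed
  with J show "?J \<and> ?A" ..
next
  assume JA: "?J \<and> ?A"
  show ?E
  proof (intro allI)
    fix a b c
    have "a \<bullet>\<^sub>C (b \<bullet>\<^sub>C c) = b \<bullet>\<^sub>C (a \<bullet>\<^sub>C c)"
      using JA commute[of a b] by metis
    with JA show "even_part a b c = 0"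
      by (simp add: even_part_def)
  qed
qed

text \<open>Puts the rule in the form 2 P_a = Q_b - Q_c, which keeps its shape when
  \<open>a\<close>, \<open>b\<close>, \<open>c\<close> are rotated.\<close>

lemma transposed_leibniz_iff:
  "2 *s (a \<bullet>\<^sub>C (b \<circ>\<^sub>L c)) - a \<bullet>\<^sub>C b \<circ>\<^sub>L c - b \<circ>\<^sub>L (a \<bullet>\<^sub>C c) = 0 \<longleftrightarrow>
    a \<bullet>\<^sub>C (b \<circ>\<^sub>L c) + a \<bullet>\<^sub>C (b \<circ>\<^sub>L c) = b \<circ>\<^sub>L (c \<bullet>\<^sub>C a) - c \<circ>\<^sub>L (a \<bullet>\<^sub>C b)"
  using anticommute[of "a \<bullet>\<^sub>C b" c] commute[of a c]
  by (simp add: circ.scale_two algebra_simps)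

lemma odd_part_eq_0_iff:
  "(\<forall>a b c. odd_part a b c = 0) \<longleftrightarrow>
    (\<forall>a b c. 2 *s (a \<bullet>\<^sub>C (b \<circ>\<^sub>L c)) - a \<bullet>\<^sub>C b \<circ>\<^sub>L c - b \<circ>\<^sub>L (a \<bullet>\<^sub>C c) = 0)"
    (is "?O \<longleftrightarrow> ?T")
proof
  assume O: ?O
  show ?T
    unfolding transposed_leibniz_iff
  proof (intro allI)
    fix a b c
    let ?p = "a \<bullet>\<^sub>C (b \<circ>\<^sub>L c)" and ?q = "b \<bullet>\<^sub>C (c \<circ>\<^sub>L a)" and ?r = "c \<bullet>\<^sub>C (a \<circ>\<^sub>L b)"
    have "?p + ?q + ?r = odd_part a b c + odd_part b c a + odd_part c a b"
      using commute[of a b] commute[of b c] commute[of c a]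
      by (simp add: odd_part_def algebra_simps)
    then have "?p + ?q + ?r = 0"
      using O by simp
    \<comment> \<open>This is the rotation in which P_a carries the minus sign, so subtracting it
      from the vanishing sum of the P doubles P_a and cancels P_b and P_c.\<close>
    moreover have "odd_part b c a = 0"
      using O by simp
    moreover have "?p + ?p - (b \<circ>\<^sub>L (c \<bullet>\<^sub>C a) - c \<circ>\<^sub>L (a \<bullet>\<^sub>C b)) = (?p + ?q + ?r) - odd_part b c a"
      using commute[of a b] by (simp add: odd_part_def algebra_simps)
    ultimately show "?p + ?p = b \<circ>\<^sub>L (c \<bullet>\<^sub>C a) - c \<circ>\<^sub>L (a \<bullet>\<^sub>C b)"
      by simp
  qed
next
  assume T: ?T
  show ?O
  proof (intro allI)
    fix a b c
    let ?p = "a \<bullet>\<^sub>C (b \<circ>\<^sub>L c)" and ?q = "b \<bullet>\<^sub>C (c \<circ>\<^sub>L a)" and ?r = "c \<bullet>\<^sub>C (a \<circ>\<^sub>L b)"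
    have p: "?p + ?p = b \<circ>\<^sub>L (c \<bullet>\<^sub>C a) - c \<circ>\<^sub>L (a \<bullet>\<^sub>C b)"
      and q: "?q + ?q = c \<circ>\<^sub>L (a \<bullet>\<^sub>C b) - a \<circ>\<^sub>L (b \<bullet>\<^sub>C c)"
      and r: "?r + ?r = a \<circ>\<^sub>L (b \<bullet>\<^sub>C c) - b \<circ>\<^sub>L (c \<bullet>\<^sub>C a)"
      using T unfolding transposed_leibniz_iff by blast+
    have "(?p + ?q + ?r) + (?p + ?q + ?r) = (?p + ?p) + (?q + ?q) + (?r + ?r)"
      by (simp add: algebra_simps)
    \<comment> \<open>The differences of the Q telescope around the cycle.\<close>
    also have "\<dots> = 0"
      unfolding p q r by (simp add: algebra_simps)
    finally have "?p + ?q + ?r = 0"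
      by (simp only: double_eq_0_iff)
    moreover have "odd_part a b c =
        (?p + ?q + ?r) - (?r + ?r) + (a \<circ>\<^sub>L (b \<bullet>\<^sub>C c) - b \<circ>\<^sub>L (c \<bullet>\<^sub>C a))"
      using commute[of a c] by (simp add: odd_part_def algebra_simps)
    ultimately show "odd_part a b c = 0"
      unfolding r by simp
  qed
qed

end

locale polarization =
  polarized_algebra scale circ bullet + nonassoc_algebra scale mult
  for scale :: "'k::field \<Rightarrow> 'a::ab_group_add \<Rightarrow> 'a" (infixr \<open>*s\<close> 75)
    and circ :: "'a \<Rightarrow> 'a \<Rightarrow> 'a" (infixl \<open>\<circ>\<^sub>L\<close> 76)
    and bullet :: "'a \<Rightarrow> 'a \<Rightarrow> 'a" (infixl \<open>\<bullet>\<^sub>C\<close> 76)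
    and mult :: "'a \<Rightarrow> 'a \<Rightarrow> 'a" (infixl \<open>\<cdot>\<close> 76) +
  assumes mult_eq: "a \<cdot> b = a \<circ>\<^sub>L b + a \<bullet>\<^sub>C b"
begin

lemma commutator_eq: "commutator (\<cdot>) a b = a \<circ>\<^sub>L b + a \<circ>\<^sub>L b"
  using anticommute[of b a] commute[of b a] by (simp add: commutator_def mult_eq)

text \<open>Since the commutator is twice \<open>\<circ>\<^sub>L\<close>, every term of the
  expansion has coefficient 2 up to sign. The terms with two factors \<open>\<circ>\<^sub>L\<close>
  form the Jacobi sum after anticommuting.\<close>

lemma left_defect_eq:
  "2 *s (a \<cdot> (b \<cdot> c)) - 2 *s (b \<cdot> (a \<cdot> c)) - commutator (\<cdot>) a b \<cdot> c =
    2 *s (even_part a b c + odd_part a b c)"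
  using anticommute[of "a \<circ>\<^sub>L b" c] anticommute[of a c] commute[of "a \<circ>\<^sub>L b" c]
  unfolding commutator_eq mult_eq circ.scale_two even_part_def odd_part_def jacobi_sum_def
  by (simp add: circ.bilinear_simps bullet.bilinear_simps algebra_simps)

text \<open>The left defect of the opposite algebra at \<open>a\<close>, \<open>b\<close>,
  \<open>c\<close>, which explains the reversed order of the variables. The sign change of
  \<open>\<circ>\<^sub>L\<close> affects just the odd part.\<close>

lemma right_defect_eq:
  "2 *s (c \<cdot> b \<cdot> a) - 2 *s (c \<cdot> a \<cdot> b) - c \<cdot> commutator (\<cdot>) b a =
    2 *s (even_part a b c - odd_part a b c)"
proof -
  \<comment> \<open>The right side expands the product of \<open>y\<close> with the product of
    \<open>x\<close> and \<open>c\<close>, both taken in the opposite algebra.\<close>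
  have swap: "c \<cdot> x \<cdot> y = y \<circ>\<^sub>L (x \<circ>\<^sub>L c) - y \<circ>\<^sub>L (x \<bullet>\<^sub>C c) - y \<bullet>\<^sub>C (x \<circ>\<^sub>L c) + y \<bullet>\<^sub>C (x \<bullet>\<^sub>C c)" for x y
    unfolding mult_eq anticommute[of "c \<circ>\<^sub>L x + c \<bullet>\<^sub>C x" y] commute[of "c \<circ>\<^sub>L x + c \<bullet>\<^sub>C x" y]
    unfolding anticommute[of c x] commute[of c x]
    by (simp add: circ.bilinear_simps bullet.bilinear_simps algebra_simps)
  show ?thesis
    unfolding swap
    unfolding commutator_eq circ.scale_two even_part_def odd_part_def jacobi_sum_def
      anticommute[of b a] anticommute[of c a]
    by (simp add: mult_eq circ.bilinear_simps bullet.bilinear_simps algebra_simps)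
qed

lemma weak_leibniz_iff:
  "weak_leibniz_algebra scale (\<cdot>) \<longleftrightarrow>
    (\<forall>a b c. even_part a b c = 0) \<and> (\<forall>a b c. odd_part a b c = 0)"
proof -
  have "weak_leibniz_algebra scale (\<cdot>) \<longleftrightarrow>
      (\<forall>a b c. 2 *s (a \<cdot> (b \<cdot> c)) - 2 *s (b \<cdot> (a \<cdot> c)) - commutator (\<cdot>) a b \<cdot> c = 0) \<and>
      (\<forall>a b c. 2 *s (c \<cdot> b \<cdot> a) - 2 *s (c \<cdot> a \<cdot> b) - c \<cdot> commutator (\<cdot>) b a = 0)"
    using nonassoc_algebra_axioms
    unfolding weak_leibniz_algebra_def weak_leibniz_algebra_axioms_def right_minus_eq
    by metis
  also have "\<dots> \<longleftrightarrow>
      (\<forall>a b c. even_part a b c + odd_part a b c = 0 \<and> even_part a b c - odd_part a b c = 0)"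
    unfolding left_defect_eq right_defect_eq using two_neq_0 by auto
  also have "\<dots> \<longleftrightarrow> (\<forall>a b c. even_part a b c = 0 \<and> odd_part a b c = 0)"
  proof -
    \<comment> \<open>Sum and difference determine both parts because 2 is invertible.\<close>
    have "x + y = 0 \<and> x - y = 0 \<longleftrightarrow> x = 0 \<and> y = 0" for x y :: 'a
      using double_eq_0_iff[of y] by auto
    then show ?thesis by simp
  qed
  finally show ?thesis by blast
qed

text \<open>Alternation and commutativity are built into the locale, so what remains is Jacobi and
  associativity, which make up the even part, and the transposed Leibniz rule, which is the odd
  part.\<close>

lemma transposed_poisson_iff:
  "transposed_poisson scale (\<circ>\<^sub>L) (\<bullet>\<^sub>C) \<longleftrightarrow>
    (\<forall>a b c. even_part a b c = 0) \<and> (\<forall>a b c. odd_part a b c = 0)"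
proof -
  have "lie_algebra scale (\<circ>\<^sub>L) \<longleftrightarrow> (\<forall>a b c. jacobi_sum a b c = 0)"
    using circ.nonassoc_algebra_axioms alternating
    by (simp add: lie_algebra_def lie_algebra_axioms_def jacobi_sum_def)
  moreover have "comm_assoc_algebra scale (\<bullet>\<^sub>C) \<longleftrightarrow>
      (\<forall>a b c. a \<bullet>\<^sub>C b \<bullet>\<^sub>C c = a \<bullet>\<^sub>C (b \<bullet>\<^sub>C c))"
    using bullet.nonassoc_algebra_axioms commute
    by (auto simp: comm_assoc_algebra_def abel_semigroup_def abel_semigroup_axioms_def
        semigroup_def)
  ultimately show ?thesis
    unfolding transposed_poisson_def transposed_poisson_axioms_def
      even_part_eq_0_iff odd_part_eq_0_iff by blast
qed

end

lemma (in nonassoc_algebra) nonassoc_algebra_polar: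
  shows "nonassoc_algebra scale (polar_circ scale (\<cdot>))"
    and "nonassoc_algebra scale (polar_bullet scale (\<cdot>))"
  by unfold_locales
    (auto simp: polar_circ_def polar_bullet_def bilinear_simps algebra_simps)

lemma (in nonassoc_algebra) polarization_polar:
  assumes "(2::'k) \<noteq> 0" and "(3::'k) \<noteq> 0"
  shows "polarization scale (polar_circ scale (\<cdot>)) (polar_bullet scale (\<cdot>)) (\<cdot>)"
proof -
  interpret circ: nonassoc_algebra scale "polar_circ scale (\<cdot>)"
    by (rule nonassoc_algebra_polar)
  interpret bullet: nonassoc_algebra scale "polar_bullet scale (\<cdot>)"
    by (rule nonassoc_algebra_polar)
  show ?thesis
  proof
    show "a \<cdot> b = polar_circ scale (\<cdot>) a b + polar_bullet scale (\<cdot>) a b" for a b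
    proof -
      \<comment> \<open>To be read with \<open>x\<close> and \<open>y\<close> the products of
        \<open>a\<close> and \<open>b\<close> in the two orders. Here 1/2 must be a true inverse of
        2, not the default value 0.\<close>
      have "(1 / 2) *s (x - y) + (1 / 2) *s (x + y) = x" for x y
        using assms(1)
        by (simp add: flip: scale_right_distrib scale_two)
      then show ?thesis
        by (simp add: polar_circ_def polar_bullet_def)
    qed
  qed (use assms in \<open>simp_all add: polar_circ_def polar_bullet_def add.commute\<close>)
qed

theorem corollary1p3:
  fixes scale :: "'k::field \<Rightarrow> 'a::ab_group_add \<Rightarrow> 'a"
    and mult :: "'a \<Rightarrow> 'a \<Rightarrow> 'a"
  assumes "CHAR('k) \<noteq> 2" and "CHAR('k) \<noteq> 3"
    and "nonassoc_algebra scale mult"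
  shows "weak_leibniz_algebra scale mult \<longleftrightarrow>
    transposed_poisson scale (polar_circ scale mult) (polar_bullet scale mult)"
proof -
  have "(2::'k) \<noteq> 0" and "(3::'k) \<noteq> 0"
    using of_nat_prime_neq_0[where 'k='k, of 2] of_nat_prime_neq_0[where 'k='k, of 3] assms(1,2)
    by simp_all
  then interpret polarization scale "polar_circ scale mult" "polar_bullet scale mult" mult
    using nonassoc_algebra.polarization_polar[OF assms(3)] by blast
  show ?thesis
    by (simp only: weak_leibniz_iff transposed_poisson_iff)
qed

end
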